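(* Let $A$ be a unital real C$^*$-algebra with unit $1$, and let $V:A\times A\to\mathbb{R}$ be an orthogonal, symmetric, bounded, bilinear form. Then, defining $\phi_1(x):=V(x,1)$ for $x\in A$, we have $$V(a,b)=\phi_1\!\left(\frac{ab+ba}{2}\right)\qquad\text{for every } a,b\in A_{sa}.$$
   Context: A real C$^*$-algebra is a real Banach $*$-algebra $A$ satisfying $\|a^*a\|=\|a\|^2$ for all $a\in A$ and such that $1+a^*a$ is invertible in the unitization of $A$ for every $a\in A$. $A_{sa}=\{a\in A: a^*=a\}$. Elements $a,b\in A$ are orthogonal, $a\perp b$, if $ab^*=b^*a=0$; $V$ is orthogonal if $V(a,b^* )=0$ whenever $a\perp b$ in $A$. *)

theory Defs
  imports Complex_Main
begin

text \<open>
  The unitization \<open>A \<oplus> \<real>\<close> of a real algebra \<open>A\<close>; the pair \<open>(a, s)\<close> stands for \<open>a + s 1\<close>.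
\<close>

definition (in real_algebra) unitization_mult ::
    "'a \<times> real \<Rightarrow> 'a \<times> real \<Rightarrow> 'a \<times> real" where
  "unitization_mult x y =
     (fst x * fst y + snd x *\<^sub>R fst y + snd y *\<^sub>R fst x, snd x * snd y)"

definition (in real_algebra) unitization_one :: "'a \<times> real" where
  "unitization_one = (0, 1)"

definition (in real_algebra) unitization_invertible :: "'a \<times> real \<Rightarrow> bool" where
  "unitization_invertible x \<longleftrightarrow>
     (\<exists>y. unitization_mult x y = unitization_one \<and> unitization_mult y x = unitization_one)"

text \<open>
  If \<open>A\<close> already has a unit \<open>e\<close>, some authors take the unitization of \<open>A\<close> to be \<open>A\<close> itself.
  For elements of the form \<open>1 + x\<close> with \<open>x \<in> A\<close> this makes no difference.
\<close>

lemma unitization_invertible_unital: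
  fixes e x :: "'a::real_algebra"
  assumes unit: "\<And>y. e * y = y" "\<And>y. y * e = y"
  shows "unitization_invertible (x, 1) \<longleftrightarrow> (\<exists>y. (e + x) * y = e \<and> y * (e + x) = e)"
proof
  assume "unitization_invertible (x, 1)"
  then obtain b where b: "x * b + b + x = 0" "b * x + x + b = 0"
    by (auto simp: unitization_invertible_def unitization_mult_def unitization_one_def)
  have "(e + x) * (e + b) = e + (x * b + b + x)" "(e + b) * (e + x) = e + (b * x + x + b)"
    by (simp_all add: algebra_simps unit)
  then show "\<exists>y. (e + x) * y = e \<and> y * (e + x) = e"
    using b by (intro exI[of _ "e + b"]) simp
next
  assume "\<exists>y. (e + x) * y = e \<and> y * (e + x) = e"
  then obtain y where y: "(e + x) * y = e" "y * (e + x) = e" by blast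
  have "x * (y - e) + (y - e) + x = (e + x) * y - e" "(y - e) * x + x + (y - e) = y * (e + x) - e"
    by (simp_all add: algebra_simps unit)
  with y have "x * (y - e) + (y - e) + x = 0" "(y - e) * x + x + (y - e) = 0"
    by simp_all
  then show "unitization_invertible (x, 1)"
    unfolding unitization_invertible_def unitization_mult_def unitization_one_def
    by (intro exI[of _ "(y - e, 1)"]) simp
qed

text \<open>
  Real C*-algebras, not assumed to be unital (so the zero algebra is included).
  The norm is submultiplicative by \<^class>\<open>real_normed_algebra\<close> and complete by \<^class>\<open>banach\<close>.
  That the involution is isometric follows from the C*-identity.
\<close>

class real_cstar_algebra = real_normed_algebra + banach +
  fixes star :: "'a \<Rightarrow> 'a"
  assumes star_add: "star (a + b) = star a + star b"
    and star_scaleR: "star (r *\<^sub>R a) = r *\<^sub>R star a"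
    and star_star: "star (star a) = a"
    and star_mult: "star (a * b) = star b * star a"
    and cstar_identity: "norm (star a * a) = (norm a)\<^sup>2"
    and one_plus_star_mult_invertible: "unitization_invertible (star a * a, 1)"

definition self_adjoint :: "'a::real_cstar_algebra set" where
  "self_adjoint = {a. star a = a}"

definition cstar_orthogonal :: "'a::real_cstar_algebra \<Rightarrow> 'a \<Rightarrow> bool" where
  "cstar_orthogonal a b \<longleftrightarrow> a * star b = 0 \<and> star b * a = 0"

definition orthogonal_form :: "('a::real_cstar_algebra \<Rightarrow> 'a \<Rightarrow> real) \<Rightarrow> bool" where
  "orthogonal_form V \<longleftrightarrow> (\<forall>a b. cstar_orthogonal a b \<longrightarrow> V a (star b) = 0)"

end

theory Submission
  imports Defs "HOL-Analysis.Elementary_Metric_Spaces"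
begin

text \<open>
  By polarization it is enough to show that the defect \<open>D x = V x x - V (x * x) e\<close> vanishes on
  self-adjoint elements. The defect is a bounded quadratic form, and it is invariant under
  \<open>x \<mapsto> x + t e\<close>. Let \<open>M\<close> be its supremum on the self-adjoint unit ball. Such an \<open>x\<close> has a positive
  part \<open>p\<close> and a negative part \<open>n\<close>, with \<open>x = p - n\<close> and \<open>p n = n p = 0\<close>, so orthogonality of \<open>V\<close> gives
  \<open>D x = D p + D n\<close>. But \<open>p\<close> lies between \<open>0\<close> and \<open>e\<close>, that is, within distance \<open>1/2\<close> of \<open>e/2\<close>, whence
  \<open>\<bar>D p\<bar> = \<bar>D (p - e/2)\<bar> \<le> M/4\<close>; the same holds for \<open>n\<close>. Hence \<open>M \<le> M/2\<close>, so \<open>M = 0\<close>.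

  The rest is the construction of \<open>p\<close> and \<open>n\<close> in a real C*-algebra (lemma
  \<open>orthogonal_decomposition\<close>). One takes \<open>p = (\<bar>x\<bar> + x)/2\<close> and \<open>n = (\<bar>x\<bar> - x)/2\<close>, where \<open>\<bar>x\<bar>\<close> is a square
  root of \<open>x * x\<close> that an explicit iteration produces as soon as \<open>\<parallel>e - x * x\<parallel> \<le> 1\<close>. This
  inequality, and the position of \<open>p\<close> and \<open>n\<close>, come from one spectral fact: a self-adjoint \<open>b\<close> of
  norm 1 cannot have both \<open>e - b\<close> and \<open>e + b\<close> invertible (lemma
  \<open>not_invertible_unit_minus_or_plus\<close>).

  To see this fact, write \<open>z\<close> for a complex number of modulus 1. Invertibility of \<open>t e + y * y\<close> for
  \<open>t > 0\<close> and self-adjoint \<open>y\<close> keeps non-real numbers out of the spectrum of \<open>b\<close>, so if \<open>e \<plusminus> b\<close> were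
  invertible, \<open>e - z b\<close> would be invertible on the whole circle. Since
  \<open>(e - z\<^sup>2 b\<^sup>2)\<inverse>\<close> is the mean of \<open>(e - z b)\<inverse>\<close> and \<open>(e + z b)\<inverse>\<close>, passing from \<open>b\<close> to \<open>b\<^sup>2\<close> halves the
  Lipschitz constant of the resolvent as a function of the angle. After many squarings the
  resolvent is almost constant on the circle, which forces the iterated square of \<open>b\<close> to be small;
  but by the C*-identity it has norm 1. Only the real part of the resolvent is used, so that no
  complexification is needed.
\<close>

section \<open>Involution and norm\<close>

lemma star_zero [simp]: "star (0::'a::real_cstar_algebra) = 0"
  using star_scaleR[of 0 "0::'a"] by simp

lemma star_minus [simp]: "star (- a) = - star (a::'a::real_cstar_algebra)"
  using star_scaleR[of "-1" a] by simp

lemma star_diff: "star (a - b) = star a - star (b::'a::real_cstar_algebra)"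
  using star_add[of a "- b"] by simp

lemma norm_star [simp]: "norm (star a) = norm (a::'a::real_cstar_algebra)"
proof -
  have le: "norm x \<le> norm (star x)" for x :: 'a
  proof (cases "x = 0")
    case False
    have "norm x * norm x \<le> norm (star x) * norm x"
      using norm_mult_ineq[of "star x" x] by (simp add: cstar_identity power2_eq_square)
    with False show ?thesis by simp
  qed simp
  from le[of a] le[of "star a"] show ?thesis by (simp add: star_star)
qed

lemma bounded_linear_star: "bounded_linear (star :: 'a::real_cstar_algebra \<Rightarrow> 'a)"
  by (intro bounded_linear_intro[of _ 1]) (simp_all add: star_add star_scaleR)

lemma norm_self_adjoint_square:
  "star x = x \<Longrightarrow> norm (x * x) = (norm (x::'a::real_cstar_algebra))\<^sup>2"
  using cstar_identity[of x] by simp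

text \<open>
  From 0 the iteration \<open>v \<mapsto> (v\<^sup>2 + 1) / 2\<close> increases to its double fixed point \<open>1\<close>. It dominates the iteration
  for the square root in the algebra, and supplies convergence in the borderline case where the
  latter need not be a uniform contraction.
\<close>

lemma scalar_square_root_iteration:
  fixes v :: "nat \<Rightarrow> real"
  assumes v0: "v 0 = 0" and vS: "\<And>n. v (Suc n) = ((v n)\<^sup>2 + 1) / 2"
  shows "Cauchy v" "\<And>n. v n \<le> 1"
proof -
  have bd: "0 \<le> v n \<and> v n \<le> 1" for n
    by (induction n) (auto simp: v0 vS power_le_one)
  then show "\<And>n. v n \<le> 1" by auto
  have inc: "incseq v"
  proof (rule incseq_SucI)
    fix n
    have "v (Suc n) - v n = (v n - 1)\<^sup>2 / 2"
      by (simp add: vS power2_eq_square field_simps)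
    then show "v n \<le> v (Suc n)" using zero_le_power2[of "v n - 1"] by linarith
  qed
  obtain l where "v \<longlonglongrightarrow> l"
    using incseq_convergent[OF inc, of 1] bd by blast
  then show "Cauchy v" by (rule LIMSEQ_imp_Cauchy)
qed

section \<open>Invertible elements\<close>

locale unital_real_cstar =
  fixes e :: "'a::real_cstar_algebra"
  assumes unit: "e * x = x" "x * e = x"
begin

definition invertible :: "'a \<Rightarrow> bool" where
  "invertible x \<longleftrightarrow> (\<exists>y. x * y = e \<and> y * x = e)"

lemma star_unit [simp]: "star e = e"
  by (metis star_mult star_star unit)

lemma norm_unit_le: "norm e \<le> 1"
proof -
  have "norm e = (norm e)\<^sup>2" using norm_self_adjoint_square[of e] by (simp add: unit)
  then show ?thesis by (cases "norm e = 0") (auto simp: power2_eq_square)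
qed

lemma invertible_mult: "invertible x \<Longrightarrow> invertible y \<Longrightarrow> invertible (x * y)"
  unfolding invertible_def
proof (elim exE conjE)
  fix x' y' assume h: "x * x' = e" "x' * x = e" "y * y' = e" "y' * y = e"
  have "x * y * (y' * x') = x * (y * y') * x'" "y' * x' * (x * y) = y' * (x' * x) * y"
    by (simp_all add: mult.assoc)
  then show "\<exists>z. x * y * z = e \<and> z * (x * y) = e"
    using h by (intro exI[of _ "y' * x'"]) (simp add: unit)
qed

lemma invertible_factor:
  assumes "x * y = y * x" "invertible (x * y)"
  shows "invertible x"
proof -
  obtain z where z: "x * y * z = e" "z * (x * y) = e"
    using assms unfolding invertible_def by blast
  have 1: "x * (y * z) = e" using z by (simp add: mult.assoc)
  have 2: "(z * y) * x = e" using z assms by (simp add: mult.assoc)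
  have "z * y = (z * y) * (x * (y * z))" by (simp add: 1 unit)
  also have "\<dots> = ((z * y) * x) * (y * z)" by (simp add: mult.assoc)
  also have "\<dots> = y * z" by (simp add: 2 unit)
  finally show ?thesis using 1 2 unfolding invertible_def by metis
qed

lemma invertible_scaleR: "r \<noteq> 0 \<Longrightarrow> invertible (r *\<^sub>R x) \<longleftrightarrow> invertible x"
proof -
  have imp: "invertible (s *\<^sub>R y)" if s: "s \<noteq> 0" and y: "invertible y" for s y
  proof -
    obtain z where "y * z = e" "z * y = e" using y unfolding invertible_def by blast
    then show ?thesis
      using s unfolding invertible_def by (intro exI[of _ "inverse s *\<^sub>R z"]) simp
  qed
  assume "r \<noteq> 0"
  then show ?thesis using imp[of r x] imp[of "inverse r" "r *\<^sub>R x"] by auto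
qed

lemma invertible_pos_plus_square:
  assumes "star x = x" "t > 0"
  shows "invertible (t *\<^sub>R e + x * x)"
proof -
  define z where "z = inverse (sqrt t) *\<^sub>R x"
  have "star z = z" by (simp add: z_def star_scaleR assms)
  then have "unitization_invertible (z * z, 1)"
    using one_plus_star_mult_invertible[of z] by simp
  then have "invertible (e + z * z)"
    using unitization_invertible_unital[of e "z * z"] unit by (simp add: invertible_def)
  moreover have "t *\<^sub>R (e + z * z) = t *\<^sub>R e + x * x"
    using assms(2) by (simp add: z_def scaleR_add_right flip: inverse_mult_distrib)
  ultimately show ?thesis using assms(2) invertible_scaleR[of t "e + z * z"] by simp
qed

text \<open>
  The Neumann series, summed as the fixed point of the contraction \<open>y \<mapsto> e + c * y\<close>.
\<close>

lemma invertible_unit_minus_small: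
  assumes "norm d < r"
  shows "invertible (r *\<^sub>R e - d)"
proof -
  have r: "r > 0" using assms norm_ge_zero[of d] by linarith
  define c where "c = inverse r *\<^sub>R d"
  have c: "norm c < 1" using assms r by (simp add: c_def field_simps)
  have "\<exists>!y. e + c * y = y"
    by (rule banach_fix_type[of "norm c"])
       (use c in \<open>auto simp: dist_norm norm_mult_ineq simp flip: right_diff_distrib\<close>)
  then obtain y where y: "e + c * y = y" by blast
  have "\<exists>!y. e + y * c = y"
    by (rule banach_fix_type[of "norm c"])
       (use c in \<open>auto simp: dist_norm norm_mult_ineq mult.commute[of "norm c"] simp flip: left_diff_distrib\<close>)
  then obtain z where z: "e + z * c = z" by blast
  have 1: "(e - c) * y = e" using y by (simp add: left_diff_distrib unit) (metis add_diff_cancel_right')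
  have 2: "z * (e - c) = e" using z by (simp add: right_diff_distrib unit) (metis add_diff_cancel_right')
  have "z = z * ((e - c) * y)" by (simp add: 1 unit)
  also have "\<dots> = y" by (simp only: mult.assoc[symmetric] 2 unit)
  finally have "invertible (e - c)" using 1 2 unfolding invertible_def by metis
  moreover have "r *\<^sub>R (e - c) = r *\<^sub>R e - d" using r by (simp add: c_def scaleR_diff_right)
  ultimately show ?thesis using r invertible_scaleR[of r "e - c"] by simp
qed

text \<open>
  Near a point \<open>c\<close>, the resolvent identity \<open>W x = W c + W c * (F c - F x) * W x\<close> bounds \<open>W x\<close> by
  \<open>2 \<parallel>W c\<parallel>\<close>; compactness of the interval turns these local bounds into a global one.
\<close>

lemma bounded_inverses_on_interval:
  fixes F :: "real \<Rightarrow> 'a"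
  assumes ab: "\<alpha> \<le> \<beta>" and cont: "\<And>c. isCont F c"
    and inv: "\<And>c. c \<in> {\<alpha>..\<beta>} \<Longrightarrow> F c * W c = e \<and> W c * F c = e"
  shows "\<exists>K. \<forall>c\<in>{\<alpha>..\<beta>}. norm (W c) \<le> K"
proof -
  define J where "J = {\<alpha>..\<beta>}"
  have "\<exists>K. \<forall>c\<in>{\<alpha>..\<beta>} \<inter> J. norm (W c) \<le> K" using ab
  proof (induction rule: Bolzano)
    case (trans u v w)
    then obtain K1 K2 where "\<forall>c\<in>{u..v} \<inter> J. norm (W c) \<le> K1"
      "\<forall>c\<in>{v..w} \<inter> J. norm (W c) \<le> K2" by blast
    then show ?case by (intro exI[of _ "max K1 K2"]) (force simp: le_max_iff_disj)
  next
    case (local c)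
    then have c: "F c * W c = e" "W c * F c = e" using inv by auto
    define \<epsilon> where "\<epsilon> = 1 / (2 * (norm (W c) + 1))"
    have "\<epsilon> > 0" by (simp add: \<epsilon>_def add_nonneg_pos)
    then obtain d where d: "d > 0" "\<And>x. dist x c < d \<Longrightarrow> dist (F x) (F c) < \<epsilon>"
      using cont[of c] unfolding continuous_at_eps_delta by blast
    have bnd: "norm (W x) \<le> 2 * norm (W c)" if x: "x \<in> {\<alpha>..\<beta>}" "dist x c < d" for x
    proof -
      have "W c * (F c - F x) * W x = (W c * F c) * W x - W c * (F x * W x)"
        by (simp add: algebra_simps)
      also have "\<dots> = W x - W c" using c inv[OF x(1)] by (simp add: unit)
      finally have "W x = W c + W c * (F c - F x) * W x" by simp
      then have "norm (W x) \<le> norm (W c) + norm (W c * (F c - F x) * W x)"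
        by (metis norm_triangle_ineq)
      also have "norm (W c * (F c - F x) * W x) \<le> norm (W c) * norm (F c - F x) * norm (W x)"
        by (meson mult_right_mono norm_ge_zero norm_mult_ineq order_trans)
      also have "\<dots> \<le> (1/2) * norm (W x)"
      proof (rule mult_right_mono)
        have "norm (W c) * norm (F c - F x) \<le> norm (W c) * \<epsilon>"
          using d(2)[OF x(2)] by (intro mult_left_mono) (auto simp: dist_norm norm_minus_commute)
        also have "\<dots> \<le> 1/2" by (simp add: \<epsilon>_def divide_simps add_nonneg_pos)
        finally show "norm (W c) * norm (F c - F x) \<le> 1/2" .
      qed simp
      finally show ?thesis by simp
    qed
    have "\<exists>K. \<forall>x\<in>{u..v} \<inter> J. norm (W x) \<le> K" if "u \<le> c \<and> c \<le> v \<and> v - u < d" for u v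
      using that by (intro exI[of _ "2 * norm (W c)"] ballI bnd) (auto simp: dist_real_def J_def)
    then show ?case using d(1) by blast
  qed
  then show ?thesis by (simp add: J_def)
qed

section \<open>The real spectrum of a self-adjoint element\<close>

text \<open>
  For \<open>c = cos \<theta>\<close> this is \<open>(e - exp (\<i>\<theta>) b) (e - exp (-\<i>\<theta>) b)\<close>.
\<close>

definition quad :: "'a \<Rightarrow> real \<Rightarrow> 'a" where
  "quad b c = e - (2 * c) *\<^sub>R b + b * b"

text \<open>
  The function \<open>H \<theta>\<close> stands for the real part of \<open>(e - exp (\<i>\<theta>) b)\<inverse>\<close>, with Lipschitz constant \<open>L\<close>.
  Clearing the denominator on one side only keeps the identities below inside the commutative
  algebra of polynomials in \<open>b\<close>.
\<close>

definition lipschitz_real_resolvent :: "'a \<Rightarrow> real \<Rightarrow> (real \<Rightarrow> 'a) \<Rightarrow> bool" where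
  "lipschitz_real_resolvent b L H \<longleftrightarrow>
     (\<forall>\<theta>. quad b (cos \<theta>) * H \<theta> = e - cos \<theta> *\<^sub>R b) \<and>
     (\<forall>\<theta> \<phi>. norm (H \<theta> - H \<phi>) \<le> L * \<bar>\<theta> - \<phi>\<bar>)"

text \<open>
  With \<open>c = cos \<theta>\<close> these are the angle doublings \<open>1 - z\<^sup>2 = (1 - z) (1 + z)\<close> for the denominator and,
  in the next lemma, \<open>1/(1 - z) + 1/(1 + z) = 2/(1 - z\<^sup>2)\<close> for the numerator, where
  \<open>z = exp (\<i>\<theta>) b\<close>.
\<close>

lemma quad_double:
  "quad (b * b) (2 * c\<^sup>2 - 1) = quad b c * quad b (- c)"
  "quad (b * b) (2 * c\<^sup>2 - 1) = quad b (- c) * quad b c"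
  by (simp_all add: quad_def algebra_simps unit power2_eq_square scaleR_2)

lemma quad_numerators:
  "quad b (- c) * (e - c *\<^sub>R b) + quad b c * (e + c *\<^sub>R b)
     = 2 *\<^sub>R (e - (2 * c\<^sup>2 - 1) *\<^sub>R (b * b))"
  by (simp add: quad_def algebra_simps unit power2_eq_square scaleR_2) (simp flip: scaleR_add_left)

text \<open>
  The resolvent of \<open>b * b\<close> at the angle \<open>\<theta>\<close> is the mean of those of \<open>b\<close> at the two angles whose double
  is \<open>\<theta>\<close> modulo \<open>2 pi\<close>. Halving the angle halves the Lipschitz constant.
\<close>

lemma lipschitz_real_resolvent_square:
  assumes "lipschitz_real_resolvent b L H"
  shows "lipschitz_real_resolvent (b * b) (L / 2) (\<lambda>\<theta>. (1/2) *\<^sub>R (H (\<theta>/2) + H (\<theta>/2 + pi)))"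
  unfolding lipschitz_real_resolvent_def
proof (intro conjI allI)
  fix \<theta> :: real
  define c where "c = cos (\<theta>/2)"
  have cos: "cos \<theta> = 2 * c\<^sup>2 - 1" using cos_double_cos[of "\<theta>/2"] by (simp add: c_def)
  have H: "quad b c * H (\<theta>/2) = e - c *\<^sub>R b" "quad b (-c) * H (\<theta>/2 + pi) = e + c *\<^sub>R b"
    using assms unfolding lipschitz_real_resolvent_def c_def
    by (metis, metis (no_types) cos_periodic_pi diff_minus_eq_add scaleR_minus_left)
  have "quad (b * b) (cos \<theta>) * (H (\<theta>/2) + H (\<theta>/2 + pi))
     = quad b (-c) * (quad b c * H (\<theta>/2)) + quad b c * (quad b (-c) * H (\<theta>/2 + pi))"
    unfolding cos distrib_left by (metis mult.assoc quad_double)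
  also have "\<dots> = 2 *\<^sub>R (e - cos \<theta> *\<^sub>R (b * b))"
    unfolding H cos by (rule quad_numerators)
  finally show "quad (b * b) (cos \<theta>) * ((1/2) *\<^sub>R (H (\<theta>/2) + H (\<theta>/2 + pi)))
     = e - cos \<theta> *\<^sub>R (b * b)" by simp
next
  fix \<theta> \<phi> :: real
  have L: "norm (H x - H y) \<le> L * \<bar>x - y\<bar>" for x y
    using assms unfolding lipschitz_real_resolvent_def by blast
  have "norm ((H (\<theta>/2) + H (\<theta>/2 + pi)) - (H (\<phi>/2) + H (\<phi>/2 + pi)))
     \<le> norm (H (\<theta>/2) - H (\<phi>/2)) + norm (H (\<theta>/2 + pi) - H (\<phi>/2 + pi))"
    by (metis add_diff_add norm_triangle_ineq)
  also have "\<dots> \<le> L * \<bar>\<theta>/2 - \<phi>/2\<bar> + L * \<bar>(\<theta>/2 + pi) - (\<phi>/2 + pi)\<bar>"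
    by (intro add_mono L)
  also have "\<dots> = L * \<bar>\<theta> - \<phi>\<bar>"
    by (simp add: abs_if field_simps)
  finally show "norm ((1/2) *\<^sub>R (H (\<theta>/2) + H (\<theta>/2 + pi)) - (1/2) *\<^sub>R (H (\<phi>/2) + H (\<phi>/2 + pi)))
     \<le> L / 2 * \<bar>\<theta> - \<phi>\<bar>"
    by (simp flip: scaleR_diff_right)
qed

text \<open>
  At the angles \<open>0\<close> and \<open>pi\<close> the resolvent is \<open>(e - b)\<inverse>\<close> and \<open>(e + b)\<inverse>\<close>. Their difference,
  multiplied by \<open>(e - b) (e + b)\<close>, is \<open>2 b\<close>, so it cannot be too small when \<open>b\<close> has norm 1.
\<close>

lemma lipschitz_real_resolvent_lower_bound:
  assumes "lipschitz_real_resolvent b L H" "norm b = 1" "invertible (e - b)" "invertible (e + b)"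
  shows "1 \<le> 2 * pi * L"
proof -
  have cancel: "x * h = e" if x: "invertible x" "x * x * h = x" for x h
  proof -
    obtain y where y: "y * x = e" using x unfolding invertible_def by blast
    have "x * h = (y * x) * (x * h)" by (simp add: y unit)
    also have "\<dots> = y * (x * x * h)" by (simp add: mult.assoc)
    finally show ?thesis by (simp add: x y)
  qed
  have q: "quad b 1 = (e - b) * (e - b)" "quad b (-1) = (e + b) * (e + b)"
    by (simp_all add: quad_def algebra_simps unit scaleR_2)
  have "quad b (cos 0) * H 0 = e - cos 0 *\<^sub>R b" "quad b (cos pi) * H pi = e - cos pi *\<^sub>R b"
    using assms(1) unfolding lipschitz_real_resolvent_def by blast+
  then have "(e - b) * (e - b) * H 0 = e - b" "(e + b) * (e + b) * H pi = e + b"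
    by (simp_all add: q)
  then have H: "(e - b) * H 0 = e" "(e + b) * H pi = e"
    using cancel assms(3,4) by blast+
  have "(e - b) * (e + b) * (H 0 - H pi)
      = (e + b) * ((e - b) * H 0) - (e - b) * ((e + b) * H pi)"
    by (simp add: algebra_simps unit)
  also have "\<dots> = 2 *\<^sub>R b" by (simp add: H unit scaleR_2)
  finally have "2 * norm b = norm ((e - b) * (e + b) * (H 0 - H pi))" by simp
  also have "\<dots> \<le> norm (e - b) * norm (e + b) * norm (H 0 - H pi)"
    by (meson mult_right_mono norm_ge_zero norm_mult_ineq order_trans)
  also have "\<dots> \<le> 2 * 2 * (L * pi)"
  proof (intro mult_mono)
    show "norm (e - b) \<le> 2" "norm (e + b) \<le> 2"
      using norm_triangle_ineq4[of e b] norm_triangle_ineq[of e b] norm_unit_le assms(2) by simp_all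
    show "norm (H 0 - H pi) \<le> L * pi"
      using assms(1) unfolding lipschitz_real_resolvent_def by (metis abs_minus_cancel abs_of_pos diff_0 pi_gt_zero)
  qed auto
  finally show ?thesis using assms(2) by (simp add: mult_ac)
qed

text \<open>
  All hypotheses pass from \<open>b\<close> to \<open>b * b\<close>: the norm stays 1 by the C*-identity, \<open>e + b * b\<close> is
  invertible by the defining axiom of a real C*-algebra, and \<open>e - b * b = (e - b) (e + b)\<close>. Hence
  the lower bound survives repeated halving of \<open>L\<close>.
\<close>

lemma lipschitz_real_resolvent_growth:
  assumes "lipschitz_real_resolvent b L H" "star b = b" "norm b = 1" "invertible (e - b)" "invertible (e + b)"
  shows "2 ^ n \<le> 2 * pi * L"
  using assms
proof (induction n arbitrary: b L H)
  case 0
  then show ?case using lipschitz_real_resolvent_lower_bound by simp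
next
  case (Suc n)
  have "(e - b) * (e + b) = e - b * b" by (simp add: algebra_simps unit)
  then have "invertible (e - b * b)" using invertible_mult[OF Suc.prems(4,5)] by simp
  moreover have "invertible (e + b * b)" using invertible_pos_plus_square[of b 1] Suc.prems by simp
  moreover have "star (b * b) = b * b" using Suc.prems by (simp add: star_mult)
  moreover have "norm (b * b) = 1" using Suc.prems by (simp add: norm_self_adjoint_square)
  ultimately have "2 ^ n \<le> 2 * pi * (L / 2)"
    using Suc.IH lipschitz_real_resolvent_square[OF Suc.prems(1)] by blast
  then show ?case by simp
qed

text \<open>
  In spectral terms: the norm of a self-adjoint element is attained, up to sign, in its real
  spectrum. If \<open>e - b\<close> and \<open>e + b\<close> were both invertible, the resolvent would exist and be Lipschitz on
  the whole unit circle, against the unbounded growth in the previous lemma.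
\<close>

lemma not_invertible_unit_minus_or_plus:
  assumes sa: "star b = b" and nb: "norm b = 1" and inv: "invertible (e - b)" "invertible (e + b)"
  shows False
proof -
  \<comment> \<open>Completing the square: only \<open>c = 1\<close> and \<open>c = -1\<close> are not covered by the axiom.\<close>
  have inv_quad: "invertible (quad b c)" if c: "c \<in> {-1..1}" for c
  proof (cases "\<bar>c\<bar> = 1")
    case True
    then have "quad b c = (e - b) * (e - b) \<or> quad b c = (e + b) * (e + b)"
      by (auto simp: quad_def algebra_simps unit scaleR_2 abs_if split: if_splits)
    then show ?thesis using invertible_mult inv by metis
  next
    case False
    with c have "\<bar>c\<bar> < 1" by auto
    then have "1 - c\<^sup>2 > 0" by (simp add: abs_square_less_1)
    moreover have "star (b - c *\<^sub>R e) = b - c *\<^sub>R e" by (simp add: star_diff star_scaleR sa)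
    moreover have "quad b c = (1 - c\<^sup>2) *\<^sub>R e + (b - c *\<^sub>R e) * (b - c *\<^sub>R e)"
      by (simp add: quad_def algebra_simps unit power2_eq_square flip: scaleR_add_left)
    ultimately show ?thesis using invertible_pos_plus_square by simp
  qed
  then obtain W where W: "\<And>c. c \<in> {-1..1} \<Longrightarrow> quad b c * W c = e \<and> W c * quad b c = e"
    unfolding invertible_def by metis
  have cont: "isCont (quad b) c" for c
    unfolding quad_def by (intro continuous_intros)
  obtain K where K: "\<And>c. c \<in> {-1..1} \<Longrightarrow> norm (W c) \<le> K"
    using bounded_inverses_on_interval[of "-1" 1 "quad b" W] cont W by force
  have K0: "K \<ge> 0" using K[of 0] norm_ge_zero[of "W 0"] by (simp del: norm_ge_zero)
  define h where "h c = W c * (e - c *\<^sub>R b)" for c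
  \<comment> \<open>By the resolvent identity for \<open>W\<close>, and since \<open>e - c b\<close> has norm at most 2 on the interval.\<close>
  have lip: "norm (h c - h d) \<le> (K + 4 * K\<^sup>2) * \<bar>c - d\<bar>" if cd: "c \<in> {-1..1}" "d \<in> {-1..1}" for c d
  proof -
    have res: "W c - W d = (2 * (c - d)) *\<^sub>R (W c * b * W d)"
    proof -
      have "W c - W d = W c * (quad b d * W d) - (W c * quad b c) * W d"
        using W cd by (simp add: unit)
      also have "\<dots> = W c * (quad b d - quad b c) * W d" by (simp add: algebra_simps)
      also have "quad b d - quad b c = (2 * (c - d)) *\<^sub>R b" by (simp add: quad_def algebra_simps)
      finally show ?thesis by simp
    qed
    have "norm (W c * b * W d) \<le> norm (W c) * norm b * norm (W d)"
      by (meson mult_right_mono norm_ge_zero norm_mult_ineq order_trans)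
    also have "\<dots> \<le> K * K" using K cd K0 nb by (simp add: mult_mono)
    finally have W_lip: "norm (W c - W d) \<le> 2 * \<bar>c - d\<bar> * K\<^sup>2"
      unfolding res norm_scaleR abs_mult abs_numeral power2_eq_square by (intro mult_left_mono) auto
    have "norm (e - c *\<^sub>R b) \<le> norm e + norm (c *\<^sub>R b)" by (rule norm_triangle_ineq4)
    then have num: "norm (e - c *\<^sub>R b) \<le> 2" using norm_unit_le nb cd by (simp add: abs_if split: if_splits)
    have "h c - h d = (W c - W d) * (e - c *\<^sub>R b) + (d - c) *\<^sub>R (W d * b)"
      by (simp add: h_def algebra_simps)
    then have "norm (h c - h d) \<le> norm ((W c - W d) * (e - c *\<^sub>R b)) + norm ((d - c) *\<^sub>R (W d * b))"
      by (metis norm_triangle_ineq)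
    also have "\<dots> \<le> (2 * \<bar>c - d\<bar> * K\<^sup>2) * 2 + \<bar>c - d\<bar> * K"
    proof (rule add_mono)
      show "norm ((W c - W d) * (e - c *\<^sub>R b)) \<le> (2 * \<bar>c - d\<bar> * K\<^sup>2) * 2"
        by (rule order_trans[OF norm_mult_ineq]) (intro mult_mono W_lip num; simp)
      have "norm (W d * b) \<le> K" using norm_mult_ineq[of "W d" b] K[OF cd(2)] nb by simp
      then show "norm ((d - c) *\<^sub>R (W d * b)) \<le> \<bar>c - d\<bar> * K"
        by (simp add: abs_minus_commute mult_left_mono)
    qed
    finally show ?thesis by (simp add: algebra_simps)
  qed
  have "lipschitz_real_resolvent b (K + 4 * K\<^sup>2) (\<lambda>\<theta>. h (cos \<theta>))"
    unfolding lipschitz_real_resolvent_def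
  proof (intro conjI allI)
    fix \<theta> :: real
    show "quad b (cos \<theta>) * h (cos \<theta>) = e - cos \<theta> *\<^sub>R b"
      using W[of "cos \<theta>"] by (simp add: h_def unit flip: mult.assoc)
  next
    fix \<theta> \<phi> :: real
    have "\<bar>cos \<theta> - cos \<phi>\<bar> \<le> \<bar>\<theta> - \<phi>\<bar>"
    proof -
      have s: "\<bar>sin ((\<phi> - \<theta>)/2)\<bar> \<le> \<bar>(\<phi> - \<theta>)/2\<bar>" by (rule abs_sin_x_le_abs_x)
      have "\<bar>cos \<theta> - cos \<phi>\<bar> = 2 * (\<bar>sin ((\<theta> + \<phi>)/2)\<bar> * \<bar>sin ((\<phi> - \<theta>)/2)\<bar>)"
        by (simp add: cos_diff_cos abs_mult)
      also have "\<dots> \<le> 2 * (1 * \<bar>(\<phi> - \<theta>)/2\<bar>)"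
        by (intro mult_left_mono mult_mono s) auto
      finally show ?thesis by simp
    qed
    then have "(K + 4 * K\<^sup>2) * \<bar>cos \<theta> - cos \<phi>\<bar> \<le> (K + 4 * K\<^sup>2) * \<bar>\<theta> - \<phi>\<bar>"
      using K0 by (intro mult_left_mono) auto
    then show "norm (h (cos \<theta>) - h (cos \<phi>)) \<le> (K + 4 * K\<^sup>2) * \<bar>\<theta> - \<phi>\<bar>"
      using lip[of "cos \<theta>" "cos \<phi>"] by simp
  qed
  then have "2 ^ n \<le> 2 * pi * (K + 4 * K\<^sup>2)" for n
    using lipschitz_real_resolvent_growth assms by blast
  moreover obtain n where "2 * pi * (K + 4 * K\<^sup>2) < 2 ^ n"
    using real_arch_pow[of 2 "2 * pi * (K + 4 * K\<^sup>2)"] by auto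
  ultimately show False by (meson not_le)
qed

section \<open>Positive elements and square roots\<close>

text \<open>
  A self-adjoint element of norm at most 1 with no negative spectrum lies between \<open>0\<close> and \<open>e\<close>. If the norm \<open>r\<close> of
  \<open>e - 2 p\<close> exceeded 1, then \<open>r\<close> or \<open>-r\<close> would be in the spectrum of \<open>e - 2 p\<close>, that is, \<open>(1 - r)/2 < 0\<close>
  or \<open>(1 + r)/2 > 1\<close> in that of \<open>p\<close>.
\<close>

lemma norm_unit_minus_double_le:
  assumes sa: "star p = p" and np: "norm p \<le> 1"
    and inv: "\<And>t. t > 0 \<Longrightarrow> invertible (t *\<^sub>R e + p)"
  shows "norm (e - 2 *\<^sub>R p) \<le> 1"
proof (rule ccontr)
  define r where "r = norm (e - 2 *\<^sub>R p)"
  assume "\<not> ?thesis"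
  then have r: "r > 1" by (simp add: r_def)
  define b where "b = inverse r *\<^sub>R (e - 2 *\<^sub>R p)"
  have "star b = b" by (simp add: b_def star_scaleR star_diff sa)
  moreover have "norm b = 1" using r by (simp add: b_def flip: r_def)
  moreover have "invertible (e - b)"
  proof -
    have coeff: "(2 / r) * ((r - 1) / 2) = (r - 1) / r" using r by (simp add: field_simps)
    have "(2 / r) *\<^sub>R (((r - 1) / 2) *\<^sub>R e + p) = ((r - 1) / r) *\<^sub>R e + (2 / r) *\<^sub>R p"
      by (simp only: scaleR_add_right scaleR_scaleR coeff)
    also have "(r - 1) / r = 1 - inverse r" using r by (simp add: field_simps)
    finally have eq: "(2 / r) *\<^sub>R (((r - 1) / 2) *\<^sub>R e + p) = (1 - inverse r) *\<^sub>R e + (2 / r) *\<^sub>R p" .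
    have "e - b = (2 / r) *\<^sub>R (((r - 1) / 2) *\<^sub>R e + p)"
      unfolding eq by (simp add: b_def scaleR_diff_right scaleR_diff_left inverse_eq_divide)
    then show ?thesis using r inv[of "(r - 1) / 2"] invertible_scaleR by simp
  qed
  moreover have "invertible (e + b)"
  proof -
    have coeff: "(2 / r) * ((r + 1) / 2) = (r + 1) / r" using r by (simp add: field_simps)
    have "(2 / r) *\<^sub>R (((r + 1) / 2) *\<^sub>R e - p) = ((r + 1) / r) *\<^sub>R e - (2 / r) *\<^sub>R p"
      by (simp only: scaleR_diff_right scaleR_scaleR coeff)
    also have "(r + 1) / r = 1 + inverse r" using r by (simp add: field_simps)
    finally have eq: "(2 / r) *\<^sub>R (((r + 1) / 2) *\<^sub>R e - p) = (1 + inverse r) *\<^sub>R e - (2 / r) *\<^sub>R p" .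
    have "e + b = (2 / r) *\<^sub>R (((r + 1) / 2) *\<^sub>R e - p)"
      unfolding eq by (simp add: b_def scaleR_diff_right scaleR_add_left inverse_eq_divide)
    then show ?thesis using r np invertible_unit_minus_small[of p "(r + 1) / 2"] invertible_scaleR by simp
  qed
  ultimately show False by (rule not_invertible_unit_minus_or_plus)
qed

text \<open>
  With \<open>d = e - b\<close>, a solution of \<open>x = (x * x + d) / 2\<close> gives \<open>(e - x) * (e - x) = b\<close>. The iterates
  \<open>w n\<close> from \<open>0\<close> are polynomials in \<open>d\<close> with nonnegative coefficients, and so are their successive
  differences; the norms of both are therefore bounded by the values at \<open>d = 1\<close>, which form the
  scalar sequence \<open>v\<close>. That is why \<open>\<parallel>d\<parallel> \<le> 1\<close> suffices.
\<close>

lemma square_root_exists: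
  assumes sa: "star b = b" and nb: "norm (e - b) \<le> 1"
  obtains y where "star y = y" "y * y = b" "norm (e - y) \<le> 1"
    "\<And>z. z * b = b * z \<Longrightarrow> z * y = y * z"
proof -
  define d where "d = e - b"
  define w where "w = rec_nat (0::'a) (\<lambda>_ x. (1/2) *\<^sub>R (x * x + d))"
  define v where "v = rec_nat (0::real) (\<lambda>_ x. (x\<^sup>2 + 1) / 2)"
  have w0: "w 0 = 0" and wS: "\<And>n. w (Suc n) = (1/2) *\<^sub>R (w n * w n + d)" by (simp_all add: w_def)
  have v0: "v 0 = 0" and vS: "\<And>n. v (Suc n) = ((v n)\<^sup>2 + 1) / 2" by (simp_all add: v_def)
  note v = scalar_square_root_iteration[of v, OF v0 vS]
  have sd: "star d = d" by (simp add: d_def star_diff sa)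
  have nd: "norm d \<le> 1" using nb by (simp add: d_def)
  have w_sa: "star (w n) = w n" for n
    by (induction n) (simp_all add: w0 wS star_scaleR star_add star_mult sd)
  have comm: "z * w n = w n * z" if "z * d = d * z" for z n
  proof (induction n)
    case (Suc n)
    have "z * (w n * w n) = w n * w n * z" by (metis Suc mult.assoc)
    then show ?case by (simp add: wS distrib_left distrib_right that)
  qed (simp add: w0)
  have wd: "w n * d = d * w n" for n using comm[of d n] by simp
  have ww: "w m * w n = w n * w m" for m n using comm[of "w m" n] wd by simp
  have nw: "norm (w n) \<le> v n" for n
  proof (induction n)
    case (Suc n)
    have "norm (w n * w n) \<le> (v n)\<^sup>2"
      by (rule order_trans[OF norm_mult_ineq]) (simp add: power2_eq_square mult_mono' Suc)
    then show ?case using norm_triangle_ineq[of "w n * w n" d] nd by (simp add: wS vS)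
  qed (simp add: w0 v0)
  have step: "norm (w (Suc n) - w n) \<le> v (Suc n) - v n" for n
  proof (induction n)
    case 0
    show ?case using nd by (simp add: w0 v0 wS vS)
  next
    case (Suc n)
    have eq: "w (Suc (Suc n)) - w (Suc n) = (1/2) *\<^sub>R ((w (Suc n) - w n) * (w (Suc n) + w n))"
      unfolding wS[of "Suc n"] using wS[of n] ww[of n "Suc n"]
      by (simp add: algebra_simps)
    have "norm (w (Suc (Suc n)) - w (Suc n)) = (1/2) * norm ((w (Suc n) - w n) * (w (Suc n) + w n))"
      unfolding eq by simp
    also have "\<dots> \<le> (1/2) * ((v (Suc n) - v n) * (v (Suc n) + v n))"
      by (intro mult_left_mono order_trans[OF norm_mult_ineq] mult_mono' Suc
            order_trans[OF norm_triangle_ineq] add_mono nw) auto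
    also have "\<dots> = ((v (Suc n))\<^sup>2 - (v n)\<^sup>2) / 2"
      by (simp add: power2_eq_square algebra_simps)
    also have "\<dots> = v (Suc (Suc n)) - v (Suc n)"
      unfolding vS[of "Suc n"] using vS[of n] by (simp add: field_simps)
    finally show ?case .
  qed
  have diff: "norm (w (n + k) - w n) \<le> v (n + k) - v n" for n k
  proof (induction k)
    case (Suc k)
    then show ?case
      using step[of "n + k"] norm_triangle_ineq[of "w (Suc (n + k)) - w (n + k)" "w (n + k) - w n"] by simp
  qed simp
  have "Cauchy w"
  proof (rule CauchyI')
    fix \<epsilon> :: real assume "\<epsilon> > 0"
    then obtain M where M: "\<And>m n. m \<ge> M \<Longrightarrow> n \<ge> M \<Longrightarrow> norm (v m - v n) < \<epsilon>"
      using CauchyD[OF v(1)] by blast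
    show "\<exists>M. \<forall>m\<ge>M. \<forall>n>m. dist (w m) (w n) < \<epsilon>"
    proof (intro exI[of _ M] allI impI)
      fix m n assume "M \<le> m" "m < n"
      then show "dist (w m) (w n) < \<epsilon>"
        using M[of n m] diff[of m "n - m"] by (auto simp: dist_norm norm_minus_commute)
    qed
  qed
  then obtain x where x: "w \<longlonglongrightarrow> x" using Cauchy_convergent convergent_def by blast
  have "(\<lambda>n. (1/2) *\<^sub>R (w n * w n + d)) \<longlonglongrightarrow> (1/2) *\<^sub>R (x * x + d)"
    by (intro tendsto_intros x)
  then have "w \<longlonglongrightarrow> (1/2) *\<^sub>R (x * x + d)"
    unfolding wS[symmetric] by (rule LIMSEQ_imp_Suc)
  then have fp: "x = (1/2) *\<^sub>R (x * x + d)" using x LIMSEQ_unique by blast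
  have "(\<lambda>n. star (w n)) \<longlonglongrightarrow> star x" by (rule bounded_linear.tendsto[OF bounded_linear_star x])
  then have sx: "star x = x" using x LIMSEQ_unique unfolding w_sa by blast
  have nx: "norm x \<le> 1"
    by (rule LIMSEQ_le_const2[OF tendsto_norm[OF x]]) (use nw v(2) order_trans in blast)
  show thesis
  proof
    show "star (e - x) = e - x" by (simp add: star_diff sx)
    have "2 *\<^sub>R x = x * x + d" using arg_cong[OF fp, of "\<lambda>z. 2 *\<^sub>R z"] by simp
    then have "x + x = x * x + (e - b)" by (simp add: scaleR_2 d_def)
    then show "(e - x) * (e - x) = b" by (simp add: algebra_simps unit)
    show "norm (e - (e - x)) \<le> 1" using nx by simp
    fix z assume "z * b = b * z"
    then have "z * d = d * z" by (simp add: d_def algebra_simps unit)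
    then have "(\<lambda>n. z * w n) = (\<lambda>n. w n * z)" using comm by auto
    moreover have "(\<lambda>n. z * w n) \<longlonglongrightarrow> z * x" "(\<lambda>n. w n * z) \<longlonglongrightarrow> x * z" by (intro tendsto_intros x)+
    ultimately have "z * x = x * z" using LIMSEQ_unique by metis
    then show "z * (e - x) = (e - x) * z" by (simp add: algebra_simps unit)
  qed
qed

text \<open>
  The parts \<open>p\<close> and \<open>n\<close> are \<open>(y + x)/2\<close> and \<open>(y - x)/2\<close> for a square root \<open>y\<close> of \<open>x * x\<close> that commutes with
  \<open>x\<close>; then \<open>4 p n = y\<^sup>2 - x\<^sup>2 = 0\<close>. The last two conclusions say that \<open>p\<close> and \<open>n\<close> lie between \<open>0\<close> and \<open>e\<close>.
\<close>

lemma orthogonal_decomposition: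
  assumes sa: "star x = x" and nx: "norm x \<le> 1"
  obtains p n where "star p = p" "star n = n" "x = p - n" "p * n = 0" "n * p = 0"
    "norm (e - 2 *\<^sub>R p) \<le> 1" "norm (e - 2 *\<^sub>R n) \<le> 1"
proof -
  have sxx: "star (x * x) = x * x" by (simp add: star_mult sa)
  have "norm (x * x) \<le> 1" using nx by (simp add: norm_self_adjoint_square[OF sa] power_le_one)
  then have "norm (e - 2 *\<^sub>R (x * x)) \<le> 1"
    using norm_unit_minus_double_le[OF sxx] invertible_pos_plus_square[OF sa] by blast
  moreover have "e - x * x = (1/2) *\<^sub>R (e + (e - 2 *\<^sub>R (x * x)))"
  proof -
    have "e + (e - 2 *\<^sub>R (x * x)) = 2 *\<^sub>R (e - x * x)" by (simp add: scaleR_2)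
    then show ?thesis by simp
  qed
  ultimately have "norm (e - x * x) \<le> 1"
    using norm_triangle_ineq[of e "e - 2 *\<^sub>R (x * x)"] norm_unit_le by simp
  from square_root_exists[OF sxx this] obtain y where
    y: "star y = y" "y * y = x * x" "norm (e - y) \<le> 1" "x * y = y * x"
    by (metis mult.assoc)
  define p where "p = (1/2) *\<^sub>R (y + x)"
  define n where "n = (1/2) *\<^sub>R (y - x)"
  have s: "star p = p" "star n = n" by (simp_all add: p_def n_def star_scaleR star_add star_diff y sa)
  have "p - n = (1/2) *\<^sub>R ((y + x) - (y - x))" "p + n = (1/2) *\<^sub>R ((y + x) + (y - x))"
    by (simp_all only: p_def n_def scaleR_diff_right scaleR_add_right)
  moreover have "(y + x) - (y - x) = 2 *\<^sub>R x" "(y + x) + (y - x) = 2 *\<^sub>R y"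
    by (simp_all add: scaleR_2)
  ultimately have x: "x = p - n" and yy: "y = p + n" by simp_all
  have pn: "p * n = 0" "n * p = 0"
    by (simp_all add: p_def n_def algebra_simps y)
  \<comment> \<open>Both parts satisfy \<open>q * q = q * x\<close> up to sign, so the C*-identity gives \<open>\<parallel>q\<parallel> \<le> \<parallel>x\<parallel>\<close>.\<close>
  have np: "norm q \<le> 1" if "star q = q" "norm (q * q) \<le> norm (q * x)" for q
  proof (cases "q = 0")
    case False
    have "norm q * norm q \<le> norm q * norm x"
      using that norm_mult_ineq[of q x] by (simp add: norm_self_adjoint_square power2_eq_square)
    with False nx show ?thesis by (metis mult_left_le_imp_le order_trans zero_less_norm_iff)
  qed simp
  have npn: "norm p \<le> 1" "norm n \<le> 1"
    using s pn by (auto intro!: np simp: x algebra_simps)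
  \<comment> \<open>The two factors commute and \<open>(t e + p) (t e + n) = t (t e + y)\<close>; the right-hand side is
      invertible because \<open>y\<close> lies in the unit ball around \<open>e\<close>.\<close>
  have inv: "invertible (t *\<^sub>R e + p)" "invertible (t *\<^sub>R e + n)" if l: "t > 0" for t
  proof -
    have "invertible ((t + 1) *\<^sub>R e - (e - y))" using y l by (intro invertible_unit_minus_small) simp
    moreover have "(t + 1) *\<^sub>R e - (e - y) = t *\<^sub>R e + y" by (simp add: scaleR_add_left)
    ultimately have "invertible (t *\<^sub>R (t *\<^sub>R e + y))"
      using l invertible_scaleR[of t "t *\<^sub>R e + y"] by simp
    moreover have "(t *\<^sub>R e + p) * (t *\<^sub>R e + n) = t *\<^sub>R (t *\<^sub>R e + y)"
      "(t *\<^sub>R e + n) * (t *\<^sub>R e + p) = t *\<^sub>R (t *\<^sub>R e + y)"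
      by (simp_all add: yy algebra_simps unit pn)
    ultimately show "invertible (t *\<^sub>R e + p)" "invertible (t *\<^sub>R e + n)"
      by (metis invertible_factor)+
  qed
  show thesis
    using that[OF s x pn] norm_unit_minus_double_le s npn inv by blast
qed

section \<open>Orthogonal forms\<close>

text \<open>
  The halving argument for the defect \<open>D\<close>: splitting \<open>x\<close> into orthogonal parts produces two
  summands, while recentring each part at \<open>e/2\<close> and rescaling to the unit ball gains a factor 4.
\<close>

lemma orthogonal_form_diagonal:
  fixes V :: "'a \<Rightarrow> 'a \<Rightarrow> real"
  assumes orth: "orthogonal_form V" and symm: "\<And>a b. V a b = V b a"
    and bdd: "bounded_bilinear V" and sa: "star a = a"
  shows "V a a = V (a * a) e"
proof -
  interpret V: bounded_bilinear V by (rule bdd)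
  note V_simps = V.add_left V.add_right V.diff_left V.diff_right V.scaleR_left V.scaleR_right
  define D where "D x = V x x - V (x * x) e" for x
  have D_scale: "D (r *\<^sub>R x) = r\<^sup>2 * D x" for r x
    by (simp add: D_def V_simps power2_eq_square algebra_simps)
  have D_shift: "D (e - 2 *\<^sub>R x) = 4 * D x" for x
    by (simp add: D_def V_simps algebra_simps unit symm[of e x])
  obtain C where C: "C \<ge> 0" "\<And>x y. norm (V x y) \<le> norm x * norm y * C"
    using V.nonneg_bounded by blast
  have base: "\<bar>D x\<bar> \<le> 2 * C" if "norm x \<le> 1" for x
  proof -
    have "norm (x * x) \<le> 1" using norm_mult_ineq[of x x] that mult_le_one[of "norm x" "norm x"] by simp
    then have "norm (x * x) * norm e \<le> 1" using norm_unit_le by (simp add: mult_le_one)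
    moreover have "norm x * norm x \<le> 1" using that by (simp add: mult_le_one)
    ultimately have "\<bar>V x x\<bar> \<le> C" "\<bar>V (x * x) e\<bar> \<le> C"
      using C(2)[of x x] C(2)[of "x * x" e] mult_right_mono[OF _ C(1)] by force+
    then show ?thesis by (simp add: D_def)
  qed
  have halve: "\<bar>D x\<bar> \<le> 2 * C / 2 ^ k" if "star x = x" "norm x \<le> 1" for x k
    using that
  proof (induction k arbitrary: x)
    case 0
    then show ?case using base by simp
  next
    case (Suc k)
    obtain p n where pn: "star p = p" "star n = n" "x = p - n" "p * n = 0" "n * p = 0"
      "norm (e - 2 *\<^sub>R p) \<le> 1" "norm (e - 2 *\<^sub>R n) \<le> 1"
      using orthogonal_decomposition[OF Suc.prems] by blast
    have "cstar_orthogonal p n" using pn by (simp add: cstar_orthogonal_def)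
    then have "V p n = 0" using orth pn unfolding orthogonal_form_def by metis
    then have "D x = D p + D n"
      using pn(4,5) by (simp add: D_def pn(3) V_simps algebra_simps symm[of n p])
    then have "D x = (D (e - 2 *\<^sub>R p) + D (e - 2 *\<^sub>R n)) / 4" by (simp add: D_shift)
    moreover have "\<bar>D (e - 2 *\<^sub>R p)\<bar> \<le> 2 * C / 2 ^ k" "\<bar>D (e - 2 *\<^sub>R n)\<bar> \<le> 2 * C / 2 ^ k"
      by (intro Suc.IH; simp add: star_diff star_scaleR pn)+
    moreover have "\<bar>(u + v) / 4\<bar> \<le> B / 2" if "\<bar>u\<bar> \<le> B" "\<bar>v\<bar> \<le> B" for u v B :: real
      using that by (simp add: abs_le_iff)
    ultimately have "\<bar>D x\<bar> \<le> (2 * C / 2 ^ k) / 2" by metis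
    then show ?case by simp
  qed
  have ball: "D x = 0" if "star x = x" "norm x \<le> 1" for x
  proof -
    have "(\<lambda>k. 2 * C / 2 ^ k) \<longlonglongrightarrow> 0"
      using LIMSEQ_divide_realpow_zero[of 2 "2 * C"] by simp
    then have "\<bar>D x\<bar> \<le> 0" by (rule LIMSEQ_le_const) (use halve[OF that] in auto)
    then show ?thesis by simp
  qed
  have "D (inverse (norm a) *\<^sub>R a) = 0"
    by (rule ball) (simp_all add: star_scaleR sa field_simps)
  moreover have "D 0 = 0" by (simp add: D_def V.zero_left)
  ultimately have "D a = 0" by (cases "a = 0") (simp_all add: D_scale)
  then show ?thesis by (simp add: D_def)
qed

end

theorem proposition1p5:
  fixes V :: "'a::real_cstar_algebra \<Rightarrow> 'a \<Rightarrow> real"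
    and e :: 'a
    and \<phi>\<^sub>1 :: "'a \<Rightarrow> real"
  assumes unit: "\<And>x. e * x = x" "\<And>x. x * e = x"
    and orth: "orthogonal_form V"
    and symm: "\<And>a b. V a b = V b a"
    and bdd: "bounded_bilinear V"
    and phi1: "\<And>x. \<phi>\<^sub>1 x = V x e"
  shows "\<forall>a\<in>self_adjoint. \<forall>b\<in>self_adjoint. V a b = \<phi>\<^sub>1 ((1 / 2) *\<^sub>R (a * b + b * a))"
proof (intro ballI)
  fix a b :: 'a assume ab: "a \<in> self_adjoint" "b \<in> self_adjoint"
  interpret unital_real_cstar e by unfold_locales (fact unit)+
  interpret V: bounded_bilinear V by (rule bdd)
  have diag: "V x x = V (x * x) e" if "star x = x" for x
    using orthogonal_form_diagonal[OF orth symm bdd that] .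
  have "V (a + b) (a + b) = V ((a + b) * (a + b)) e" "V a a = V (a * a) e" "V b b = V (b * b) e"
    using ab by (auto intro!: diag simp: self_adjoint_def star_add)
  then have "2 * V a b = V (a * b + b * a) e"
    by (simp add: V.add_left V.add_right distrib_left distrib_right symm[of b a])
  then show "V a b = \<phi>\<^sub>1 ((1 / 2) *\<^sub>R (a * b + b * a))"
    by (simp add: phi1 V.scaleR_left)
qed

end
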